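(* Let $\ell$ be an odd prime. Assume that the number of primes $p\in S^1(\ell,T)$ that are essential for $\Phi_\ell(X)$ is $o(T)$ as $T\to\infty$. Then $|S^2(\ell,T)|=o(T)$ as $T\to\infty$.
   Context: $\Phi_\ell(X)$ denotes the $\ell$-th cyclotomic polynomial. For a natural number $n$, $R_\ell(n):=\min\{d\in\mathbb{N}: n\mid \Phi_\ell(d)\}$ if such $d$ exists, and $R_\ell(n)=\infty$ otherwise. $\mathbb{P}$ denotes the set of primes $p$ that divide $\Phi_\ell(d)$ for some $d\in\mathbb{N}$. For a positive integer $i$ and real $T$, $S^i(\ell,T):=\{p\in\mathbb{P}: R_\ell(p^i)\le T\}$. A prime $p$ is called essential for $\Phi_\ell(X)$ if for every integer $c$ with $|cp|<\Phi_\ell(p^{2/\ell})$ the polynomial $\Phi_\ell(X)-cp$ is irreducible over $\mathbb{Q}$. *)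

theory Defs
  imports "HOL-Computational_Algebra.Computational_Algebra" "HOL-Library.Extended_Nat"
    "HOL-Library.Landau_Symbols" Complex_Main
begin

fun cyclotomic :: "nat \<Rightarrow> int poly" where
  "cyclotomic n =
     (if n = 0 then 1
      else (monom 1 n - 1) div prod_list (map cyclotomic (filter (\<lambda>d. d dvd n) [1..<n])))"

declare cyclotomic.simps [simp del]

text \<open>R_l(n) = min {d in N : n | Phi_l(d)}, or infinity. Natural numbers start at 1.\<close>
definition R :: "nat \<Rightarrow> nat \<Rightarrow> enat" where
  "R l n = (if \<exists>d::nat. d \<ge> 1 \<and> int n dvd poly (cyclotomic l) (int d)
            then enat (LEAST d::nat. d \<ge> 1 \<and> int n dvd poly (cyclotomic l) (int d))
            else \<infinity>)"

definition PP :: "nat \<Rightarrow> nat set" where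
  "PP l = {p. prime p \<and> (\<exists>d::nat. d \<ge> 1 \<and> int p dvd poly (cyclotomic l) (int d))}"

definition S :: "nat \<Rightarrow> nat \<Rightarrow> real \<Rightarrow> nat set" where
  "S i l T = {p \<in> PP l. R l (p ^ i) \<noteq> \<infinity> \<and> real (the_enat (R l (p ^ i))) \<le> T}"

definition essential :: "nat \<Rightarrow> nat \<Rightarrow> bool" where
  "essential l p \<longleftrightarrow>
     (\<forall>c::int. real_of_int \<bar>c * int p\<bar> <
          poly (map_poly real_of_int (cyclotomic l)) (real p powr (2 / real l))
        \<longrightarrow> irreducible (map_poly rat_of_int (cyclotomic l - [:c * int p:])))"

end

theory Submission
  imports Defs "HOL-Complex_Analysis.Cauchy_Integral_Formula" "HOL-Real_Asymp.Real_Asymp"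
begin

text \<open>
  The essential primes in \<open>S\<^sup>2(l,T)\<close> lie in \<open>S\<^sup>1(l,T)\<close>, so only the non-essential ones have to be
  counted, and at most \<open>sqrt T\<close> of them are \<open>\<le> sqrt T\<close>. If \<open>p\<close> is not essential, then
  \<open>\<Phi>\<^sub>l(X) - t = g(X) h(X)\<close> for a multiple \<open>t \<noteq> 0\<close> of \<open>p\<close>, with \<open>g\<close>, \<open>h\<close> monic and integral and
  with all roots of size \<open>O(p\<^bsup>2/l\<^esup>)\<close>. From \<open>p\<^sup>2 \<le> l T\<^bsup>l-1\<^esup>\<close> the trace of \<open>g\<close> (the sum of its roots) is
  an integer of size \<open>O(T\<^bsup>1-1/l\<^esup>)\<close>. The point is that a given trace occurs for only boundedly
  many large \<open>t\<close>. As \<open>t\<close> is \<open>O(T\<^bsup>l-1\<^esup>)\<close>, it has boundedly many prime factors \<open>> sqrt T\<close>, and so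
  there are \<open>O(T\<^bsup>1-1/l\<^esup>)\<close> non-essential primes \<open>> sqrt T\<close>.

  Bounded multiplicity of the trace: put \<open>m = l - 1\<close> and \<open>s = \<bar>t\<bar>\<^bsup>1/m\<^esup>\<close>. Each root of \<open>\<Phi>\<^sub>l - t\<close> satisfies
  \<open>x + 1/m + G(x) = \<zeta> s\<close> with \<open>\<zeta>\<^bsup>2m\<^esup> = 1\<close>, where \<open>G\<close> is small and has a small Lipschitz constant
  near infinity. Let \<open>\<sigma>\<close> be the sum of the \<open>\<zeta>\<close> belonging to the \<open>k\<close> roots of \<open>g\<close>.
  If \<open>\<sigma> = 0\<close>, then the trace is close to \<open>-k/m\<close> and is not an integer. If \<open>\<sigma> \<noteq> 0\<close>,
  then the trace is a strictly monotone function of \<open>s\<close> up to the factor \<open>\<sigma>\<close>, because the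
  contribution of \<open>G\<close> varies more slowly than \<open>\<sigma> s\<close>.
\<close>

subsection \<open>Integer and complex polynomials\<close>

lemma of_int_poly_mult:
  "map_poly (of_int :: int \<Rightarrow> 'a :: comm_ring_1) (p * q) = map_poly of_int p * map_poly of_int q"
  by (rule poly_eqI) (simp add: coeff_map_poly coeff_mult)

lemma rat_poly_clear_denominators:
  fixes u :: "rat poly"
  obtains d :: int and q :: "int poly" where "d \<noteq> 0" "smult (of_int d) u = map_poly of_int q"
proof -
  have "\<exists>d q. d \<noteq> 0 \<and> smult (of_int d) u = map_poly of_int q"
  proof (induction u)
    case 0
    show ?case by (rule exI[of _ 1], rule exI[of _ 0]) simp
  next
    case (pCons a u)
    then obtain d q where dq: "d \<noteq> 0" "smult (of_int d) u = map_poly of_int q" by blast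
    obtain b c where bc: "a = of_int b / of_int c" "c \<noteq> 0"
    proof (cases a)
      case (Fract b c)
      then show ?thesis using that by (auto simp: Fract_of_int_quotient)
    qed
    have "smult (of_int (c * d)) (pCons a u) = map_poly of_int (pCons (b * d) (smult c q))"
    proof (rule poly_eqI)
      fix i
      show "coeff (smult (of_int (c * d)) (pCons a u)) i
        = coeff (map_poly rat_of_int (pCons (b * d) (smult c q))) i"
        using bc arg_cong[OF dq(2), of "\<lambda>p. coeff p (i - 1)"]
        by (cases i) (auto simp: coeff_map_poly coeff_pCons)
    qed
    then show ?case using bc dq by (metis mult_eq_0_iff)
  qed
  then show ?thesis using that by blast
qed

text \<open>Gauss's lemma. Clearing denominators in a rational factorization and passing to
  primitive parts gives integral factors. Their leading coefficients multiply to 1, so both are 1 or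
  both are -1, and a change of sign makes them monic.\<close>

lemma monic_int_factorization:
  fixes Q :: "int poly"
  assumes monic: "lead_coeff Q = 1" and pos: "degree Q > 0"
    and red: "\<not> irreducible (map_poly rat_of_int Q)"
  obtains g h where "Q = g * h" "lead_coeff g = 1" "lead_coeff h = 1"
    "0 < degree g" "0 < degree h"
proof -
  let ?r = "map_poly rat_of_int"
  have degr: "degree (?r q) = degree q" for q by (simp add: degree_map_poly)
  have "?r Q \<noteq> 0" using pos degr[of Q] by auto
  then have "\<not> is_unit (?r Q)"
    using pos degr[of Q] by (simp add: is_unit_iff_degree)
  then obtain u v where uv: "?r Q = u * v" "\<not> is_unit u" "\<not> is_unit v"
    using red \<open>?r Q \<noteq> 0\<close> unfolding irreducible_def by blast
  have nz: "u \<noteq> 0" "v \<noteq> 0" using uv(1) \<open>?r Q \<noteq> 0\<close> by auto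
  then have du: "degree u > 0" and dv: "degree v > 0" using uv by (auto simp: is_unit_iff_degree)
  obtain a U where aU: "a \<noteq> 0" "smult (of_int a) u = ?r U" by (rule rat_poly_clear_denominators)
  obtain b V where bV: "b \<noteq> 0" "smult (of_int b) v = ?r V" by (rule rat_poly_clear_denominators)
  have degUV: "degree U = degree u" "degree V = degree v"
    using arg_cong[OF aU(2), of degree] arg_cong[OF bV(2), of degree] aU(1) bV(1)
    unfolding degr by simp_all
  have "?r (U * V) = smult (of_int (a * b)) (?r Q)"
    by (simp add: of_int_poly_mult uv(1) mult.commute flip: aU(2) bV(2))
  also have "\<dots> = ?r (smult (a * b) Q)"
    by (rule poly_eqI) (simp add: coeff_map_poly)
  finally have UV: "U * V = smult (a * b) Q"
    by (simp add: poly_eq_iff coeff_map_poly flip: of_int_mult)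
  have "Polynomial.content Q dvd lead_coeff Q" by (rule content_dvd_coeff)
  then have cQ: "Polynomial.content Q = 1" using monic by (metis is_unit_content_iff)
  \<comment> \<open>The primitive part of \<open>smult (a * b) Q\<close> is \<open>Q\<close> up to
    the sign of \<open>a * b\<close>. This sign squares to 1, so it can be moved into
    \<open>h\<close>.\<close>
  let ?s = "unit_factor (a * b)"
  define g h where "g = primitive_part U" and "h = smult ?s (primitive_part V)"
  have ss: "?s * ?s = 1" using aU bV by (auto simp: unit_factor_int_def sgn_mult sgn_if)
  have "primitive_part U * primitive_part V = smult ?s Q"
    using arg_cong[OF UV, of primitive_part] cQ
    by (simp add: primitive_part_mult primitive_part_smult primitive_part_prim)
  then have gh: "Q = g * h" by (simp only: g_def h_def mult_smult_right smult_smult ss smult_1_left)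
  define e where "e = lead_coeff g"
  have "e * lead_coeff h = 1" using monic by (simp add: gh lead_coeff_mult e_def)
  then have ee: "e = 1 \<and> lead_coeff h = 1 \<or> e = -1 \<and> lead_coeff h = -1"
    by (metis zmult_eq_1_iff)
  have "?s \<noteq> 0" using aU(1) bV(1) by (auto simp: sgn_eq_0_iff)
  then have deg: "degree g > 0" "degree h > 0"
    using du dv degUV by (simp_all add: g_def h_def)
  from ee show ?thesis
  proof
    assume "e = 1 \<and> lead_coeff h = 1"
    then show ?thesis using that[of g h] gh deg e_def by simp
  next
    assume "e = -1 \<and> lead_coeff h = -1"
    then show ?thesis using that[of "- g" "- h"] gh deg e_def by simp
  qed
qed

text \<open>The core of Eisenstein's criterion. If \<open>p\<close> did not divide the constant
  coefficient of \<open>h\<close>, comparing coefficients from the bottom up would make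
  \<open>p\<close> divide every coefficient of \<open>g\<close>, including the leading 1. Used for
  both orders of the factors, it puts p^2 into the constant coefficient of the product.\<close>

lemma eisenstein_constant_coeffs:
  fixes g h :: "int poly" and p :: int
  assumes p: "prime p" and g: "lead_coeff g = 1" and h: "degree h > 0"
    and dvd: "\<And>i. i < degree g + degree h \<Longrightarrow> p dvd coeff (g * h) i"
  shows "p dvd coeff h 0"
proof (rule ccontr)
  assume nd: "\<not> p dvd coeff h 0"
  have "p dvd coeff g i" if "i \<le> degree g" for i
    using that
  proof (induction i rule: less_induct)
    case (less i)
    have "coeff (g * h) i = (\<Sum>j<i. coeff g j * coeff h (i - j)) + coeff g i * coeff h 0"
      by (simp add: coeff_mult lessThan_Suc_atMost[symmetric])
    moreover have "p dvd (\<Sum>j<i. coeff g j * coeff h (i - j))"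
      using less by (intro dvd_sum) auto
    moreover have "p dvd coeff (g * h) i" using dvd less h by auto
    ultimately have "p dvd coeff g i * coeff h 0" by (simp add: dvd_add_right_iff)
    then show ?case using p nd by (simp add: prime_dvd_mult_iff)
  qed
  from this[of "degree g"] have "p dvd 1" using g by simp
  then show False using p by (simp add: not_prime_unit)
qed

lemma degree_prod_linear_factors:
  fixes xs :: "'a :: idom list"
  shows "degree (\<Prod>x\<leftarrow>xs. [:-x, 1:]) = length xs"
  by (induction xs) (simp_all add: degree_mult_eq prod_list_zero_iff image_iff del: mult_pCons_left)

lemma coeff_prod_linear_factors:
  fixes xs :: "'a :: idom list"
  shows "length xs = Suc k \<Longrightarrow> coeff (\<Prod>x\<leftarrow>xs. [:-x, 1:]) k = - sum_list xs"
proof (induction xs arbitrary: k)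
  case (Cons x xs)
  let ?q = "\<Prod>x\<leftarrow>xs. [:-x, 1:]"
  have "lead_coeff ?q = 1"
    by (induction xs) (simp_all del: mult_pCons_left add: lead_coeff_mult)
  then have lead: "coeff ?q (length xs) = 1" by (simp only: degree_prod_linear_factors)
  show ?case
  proof (cases k)
    case 0
    then show ?thesis using Cons by simp
  next
    case (Suc j)
    then show ?thesis using Cons lead by simp
  qed
qed simp

lemma monic_complex_poly_roots:
  fixes p :: "complex poly"
  assumes "lead_coeff p = 1" "degree p > 0"
  obtains xs where "length xs = degree p" "\<And>x. x \<in> set xs \<Longrightarrow> poly p x = 0"
    "sum_list xs = - coeff p (degree p - 1)"
proof -
  obtain xs where xs: "mset xs = proots p" using ex_mset by blast
  have p: "p = (\<Prod>x\<leftarrow>xs. [:-x, 1:])"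
    using complex_poly_decompose_multiset[of p] assms(1)
    by (simp flip: xs prod_mset_prod_list)
  have len: "length xs = degree p"
    using p degree_prod_linear_factors[of xs] by simp
  moreover have "poly p x = 0" if "x \<in> set xs" for x
    using that unfolding p by (induction xs) auto
  moreover have "sum_list xs = - coeff p (degree p - 1)"
    using coeff_prod_linear_factors[of xs "degree p - 1"] assms(2) len p by simp
  ultimately show ?thesis using that by blast
qed

subsection \<open>Translates of a polynomial having a factor with given trace\<close>

text \<open>Put w = 1/x and m = \<open>degree P\<close>. Then P(x) = x^m Q(w) with the reversed
  polynomial Q and Q(0) = 1, so Q has a holomorphic m-th root f near 0. Writing f(w) = 1 + w F(w)
  turns x f(1/x) into x + F(1/x). Here F(0) = f'(0) is the constant term of the statement, and G(x)
  = F(1/x) - F(0) is controlled by a Lipschitz bound for F.\<close>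

lemma exists_root_near_infinity:
  fixes P :: "complex poly" and \<epsilon> :: real
  assumes monic: "lead_coeff P = 1" and pos: "degree P > 0" and "\<epsilon> > 0"
  obtains M :: real and G :: "complex \<Rightarrow> complex"
    where "M > 0"
      and "\<And>x. norm x > M \<Longrightarrow>
             (x + coeff P (degree P - 1) / of_nat (degree P) + G x) ^ degree P = poly P x"
      and "\<And>x. norm x > M \<Longrightarrow> norm (G x) \<le> \<epsilon>"
      and "\<And>x y. norm x > M \<Longrightarrow> norm y > M \<Longrightarrow> norm (G x - G y) \<le> \<epsilon> * norm (x - y)"
proof -
  define m where "m = degree P"
  define Q where "Q = reflect_poly P"
  define f where "f w = poly Q w powr (1 / of_nat m)" for w
  have Q0: "poly Q 0 = 1" using monic by (simp add: Q_def)
  \<comment> \<open>Near 0 the values of Q stay within distance 1 of 1, hence off the branch cut of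
    \<open>powr\<close>.\<close>
  have "isCont (poly Q) 0" by simp
  then obtain r where r: "r > 0" and r': "\<And>w. dist w 0 < r \<Longrightarrow> dist (poly Q w) 1 < 1"
    unfolding continuous_at_eps_delta using Q0 by (metis zero_less_one)
  have nonpos: "poly Q w \<notin> \<real>\<^sub>\<le>\<^sub>0" if "w \<in> ball 0 r" for w
  proof
    assume "poly Q w \<in> \<real>\<^sub>\<le>\<^sub>0"
    then have "Re (poly Q w) \<le> 0" by (simp add: complex_nonpos_Reals_iff)
    moreover have "\<bar>Re (poly Q w - 1)\<bar> < 1"
      using r'[of w] that abs_Re_le_cmod[of "poly Q w - 1"] by (auto simp: dist_norm)
    ultimately show False by simp
  qed
  have holf: "f holomorphic_on ball 0 r"
    unfolding f_def using nonpos by (intro holomorphic_intros) auto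
  define F where "F z = (if z = 0 then deriv f 0 else (f z - f 0) / (z - 0))" for z
  have holF: "F holomorphic_on ball 0 r"
    unfolding F_def by (rule pole_lemma_open[OF holf]) simp
  have f0: "f 0 = 1" by (simp add: f_def Q0)
  have "(f has_field_derivative (1 / of_nat m) * poly (pderiv Q) 0) (at 0)"
    unfolding f_def using nonpos[of 0] r Q0
    by (auto intro!: derivative_eq_intros)
  then have F0: "F 0 = coeff P (m - 1) / of_nat m"
    using pos by (simp add: F_def DERIV_imp_deriv poly_0_coeff_0 coeff_pderiv Q_def
        coeff_reflect_poly m_def)
  have sub: "cball 0 (r/2) \<subseteq> (ball 0 r :: complex set)" using r by auto
  have "continuous_on (cball 0 (r/2)) (deriv F)"
    using holomorphic_deriv[OF holF] sub
    by (meson holomorphic_on_imp_continuous_on holomorphic_on_subset open_ball)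
  then have "bounded (deriv F ` cball 0 (r/2))"
    by (intro compact_imp_bounded compact_continuous_image) auto
  then obtain K where K: "K > 0" "\<And>w. w \<in> cball 0 (r/2) \<Longrightarrow> norm (deriv F w) \<le> K"
    unfolding bounded_pos by auto
  have lip: "norm (F w - F z) \<le> K * norm (w - z)"
    if "w \<in> cball 0 (r/2)" "z \<in> cball 0 (r/2)" for w z
  proof (rule field_differentiable_bound[of "cball 0 (r/2)" F "deriv F"])
    fix u assume "u \<in> cball (0::complex) (r/2)"
    then show "(F has_field_derivative deriv F u) (at u within cball 0 (r/2))"
      using holomorphic_derivI[OF holF] sub by (metis has_field_derivative_at_within open_ball subsetD)
  qed (use K that in auto)
  \<comment> \<open>For \<open>norm x > M\<close> the three summands make
    \<open>norm (1 / x)\<close> at most 1, put \<open>1 / x\<close> into the half-size disc where F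
    is Lipschitz, and give \<open>K / M \<le> \<epsilon>\<close>.\<close>
  define M where "M = 1 + 2 / r + K / \<epsilon>"
  define G where "G x = F (1 / x) - F 0" for x
  have Mpos: "M > 0" "M \<ge> 1" using r K \<open>\<epsilon> > 0\<close> by (auto simp: M_def add_pos_pos)
  have KM: "K / M \<le> \<epsilon>"
  proof -
    have "K / \<epsilon> \<le> M" using r by (simp add: M_def)
    then show ?thesis using \<open>\<epsilon> > 0\<close> Mpos by (simp add: field_simps)
  qed
  have inM: "1 / x \<in> cball 0 (r/2)" "norm (1 / x) \<le> 1 / M" "x \<noteq> 0" if "norm x > M" for x :: complex
  proof -
    have x: "norm x > 0" using that Mpos by linarith
    have "norm (1 / x) \<le> 1 / M" using that Mpos x by (simp add: norm_divide frac_le)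
    moreover have "2 / r \<le> M" using K \<open>\<epsilon> > 0\<close> by (simp add: M_def)
    then have "1 / M \<le> r / 2" using Mpos r by (simp add: field_simps)
    ultimately show "1 / x \<in> cball 0 (r/2)" "norm (1 / x) \<le> 1 / M" by auto
    show "x \<noteq> 0" using x by auto
  qed
  show ?thesis
  proof (rule that[OF Mpos(1)])
    fix x :: complex assume x: "norm x > M"
    have "x + coeff P (degree P - 1) / of_nat (degree P) + G x = x * f (1 / x)"
      using inM(3)[OF x] by (simp add: G_def F0 flip: m_def) (simp add: F_def f0 field_simps)
    also have "\<dots> ^ m = x ^ m * poly Q (1 / x)"
    proof -
      have "1 / x \<in> ball 0 r" using inM[OF x] sub by blast
      then have "poly Q (1 / x) \<noteq> 0" using nonpos by force
      then show ?thesis using pos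
        by (simp add: power_mult_distrib f_def m_def powr_def flip: exp_of_nat_mult)
    qed
    also have "\<dots> = poly P x"
      using inM(3)[OF x] by (simp add: Q_def poly_reflect_poly_nz m_def inverse_eq_divide field_simps)
    finally show "(x + coeff P (degree P - 1) / of_nat (degree P) + G x) ^ degree P = poly P x"
      by (simp add: m_def)
    have "norm (G x) \<le> K * norm (1 / x)"
      using lip[of "1 / x" 0] inM[OF x] r by (simp add: G_def)
    also have "\<dots> \<le> K * (1 / M)" using inM[OF x] K by (intro mult_left_mono) auto
    finally show "norm (G x) \<le> \<epsilon>" using KM by simp
  next
    fix x y :: complex assume x: "norm x > M" and y: "norm y > M"
    have "norm (G x - G y) \<le> K * norm (1 / x - 1 / y)"
      using lip[of "1 / x" "1 / y"] inM[OF x] inM[OF y] by (simp add: G_def)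
    also have "1 / x - 1 / y = (y - x) * (1 / x) * (1 / y)"
      using inM(3)[OF x] inM(3)[OF y] by (simp add: field_simps)
    also have "K * norm \<dots> \<le> K * (norm (y - x) * (1 / M) * 1)"
    proof -
      have "norm (1 / y) \<le> 1" using inM(2)[OF y] Mpos by (meson divide_le_eq_1_pos order_trans zero_less_one)
      then show ?thesis unfolding norm_mult using inM(2)[OF x] K Mpos
        by (intro mult_left_mono mult_mono) auto
    qed
    also have "\<dots> \<le> \<epsilon> * norm (x - y)"
      using mult_right_mono[OF KM, of "norm (x - y)"] by (simp add: norm_minus_commute)
    finally show "norm (G x - G y) \<le> \<epsilon> * norm (x - y)" .
  qed
qed

text \<open>The trace of \<open>g\<close> and the list of the roots of unity attached to its roots
  together determine \<open>t\<close>. The possible lists form a finite set independent of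
  \<open>B\<close>, whose size is \<open>C\<close>, and \<open>2 * B + 1\<close> counts the traces.
  The indivisibility hypothesis rules out a vanishing sum of the roots of unity.\<close>

lemma card_reducible_translates_le:
  fixes P :: "int poly"
  assumes monic: "lead_coeff P = 1" and pos: "degree P > 0"
    and nd: "\<And>k. 0 < k \<Longrightarrow> k < degree P \<Longrightarrow>
               \<not> int (degree P) dvd int k * coeff P (degree P - 1)"
  obtains M :: real and C :: nat
    where "\<And>A B. A = {t. M < \<bar>of_int t\<bar> \<and> (\<exists>g h. P - [:t:] = g * h \<and> lead_coeff g = 1 \<and>
               0 < degree g \<and> degree g < degree P \<and> \<bar>coeff g (degree g - 1)\<bar> \<le> int B)} \<Longrightarrow>
             finite A \<and> card A \<le> C * (2 * B + 1)"
proof -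
  define m where "m = degree P"
  define Pc :: "complex poly" where "Pc = map_poly of_int P"
  have degPc: "degree Pc = m" and lcPc: "lead_coeff Pc = 1" and cPc: "coeff Pc i = of_int (coeff P i)" for i
    using monic by (simp_all add: Pc_def m_def degree_map_poly coeff_map_poly)
  \<comment> \<open>Since \<open>t\<close> may be negative and s^m = |t|, the m-th power of e(x)/s
    is 1 or -1, which is why the exponent is 2m.\<close>
  define U where "U = {z::complex. z ^ (2 * m) = 1}"
  define L where "L = {zs. set zs \<subseteq> U \<and> length zs \<le> m}"
  have m: "m > 0" using pos by (simp add: m_def)
  have "finite U" unfolding U_def using m by (intro finite_roots_unity) auto
  then have finL: "finite L" unfolding L_def by (rule finite_lists_length_le)
  \<comment> \<open>A positive lower bound for all nonzero sums of such lists; the inserted 1 keeps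
    the set under \<open>Min\<close> nonempty.\<close>
  define \<delta> where "\<delta> = Min (insert 1 ((norm \<circ> sum_list) ` L - {0}))"
  have fin\<delta>: "finite (insert 1 ((norm \<circ> sum_list) ` L - {0}))" using finL by simp
  have \<delta>: "\<delta> > 0" unfolding \<delta>_def using fin\<delta> by (subst Min_gr_iff) auto
  have \<delta>_le: "\<delta> \<le> norm (sum_list zs)" if "zs \<in> L" "sum_list zs \<noteq> 0" for zs
    unfolding \<delta>_def using fin\<delta> that by (intro Min_le) auto
  \<comment> \<open>The bound 1/2 lets the variation of G be absorbed in \<open>dist\<close>,
    \<delta>/(4m) makes the total variation of G at most half of that of the main term, and 1/(2m^2)
    forces an integer to vanish in \<open>nz\<close>.\<close>
  define \<epsilon> where "\<epsilon> = min (1 / 2) (min (\<delta> / (4 * m)) (1 / (2 * m ^ 2)))"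
  have \<epsilon>: "\<epsilon> > 0" "\<epsilon> \<le> 1/2" "\<epsilon> \<le> \<delta> / (4 * m)" "\<epsilon> \<le> 1 / (2 * m ^ 2)"
    using \<delta> m by (auto simp: \<epsilon>_def)
  obtain M0 G where M0: "M0 > 0"
    and G: "\<And>x. norm x > M0 \<Longrightarrow> (x + of_int (coeff P (m - 1)) / of_nat m + G x) ^ m = poly Pc x"
      "\<And>x. norm x > M0 \<Longrightarrow> norm (G x) \<le> \<epsilon>"
      "\<And>x y. norm x > M0 \<Longrightarrow> norm y > M0 \<Longrightarrow> norm (G x - G y) \<le> \<epsilon> * norm (x - y)"
    using exists_root_near_infinity[OF lcPc _ \<epsilon>(1)] m unfolding degPc cPc by metis
  define e where "e x = x + of_int (coeff P (m - 1)) / of_nat m + G x" for x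
  \<comment> \<open>If |t| exceeds the bound \<open>M1\<close> for P on this disc, all roots of P -
    t lie outside the disc, where \<open>G\<close> is controlled.\<close>
  have "bounded (poly Pc ` cball 0 M0)"
    by (intro compact_imp_bounded compact_continuous_image continuous_intros) auto
  then obtain M1 where M1: "M1 > 0" "\<And>x. x \<in> cball 0 M0 \<Longrightarrow> norm (poly Pc x) \<le> M1"
    unfolding bounded_pos by auto
  define s where "s t = root m \<bar>real_of_int t\<bar>" for t
  \<comment> \<open>Of a factor \<open>g\<close> only what the uniqueness proof uses is kept: its
    roots \<open>xs\<close>, their roots of unity \<open>zs\<close> in the same order, and its
    coefficient \<open>a\<close> below the leading one, which is minus the trace.\<close>
  define data where "data t a zs \<longleftrightarrow> (\<exists>xs. length zs < m \<and> zs \<noteq> [] \<and> zs \<in> L \<and> length xs = length zs \<and>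
      (\<forall>x\<in>set xs. norm x > M0 \<and> poly Pc x = of_int t) \<and> sum_list xs = - of_int a \<and>
      (\<forall>i<length zs. e (xs ! i) = s t * zs ! i))" for t a :: int and zs :: "complex list"
  have uniq: "t = t'" if d: "data t a zs" "data t' a zs" for t t' a zs
  proof -
    define k where "k = length zs"
    obtain xs where xs: "length xs = k" "\<And>i. i < k \<Longrightarrow> norm (xs ! i) > M0"
        "\<And>i. i < k \<Longrightarrow> poly Pc (xs ! i) = of_int t"
        "sum_list xs = - of_int a" "\<And>i. i < k \<Longrightarrow> e (xs ! i) = s t * zs ! i"
      and k: "0 < k" "k < m" "zs \<in> L"
      using d(1) unfolding data_def k_def by (metis length_greater_0_conv nth_mem)
    obtain ys where ys: "length ys = k" "\<And>i. i < k \<Longrightarrow> norm (ys ! i) > M0"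
        "\<And>i. i < k \<Longrightarrow> poly Pc (ys ! i) = of_int t'"
        "sum_list ys = - of_int a" "\<And>i. i < k \<Longrightarrow> e (ys ! i) = s t' * zs ! i"
      using d(2) unfolding data_def k_def by (metis nth_mem)
    have sum_eq: "of_real r * sum_list zs = - of_int a + of_nat k * of_int (coeff P (m - 1)) / of_nat m
        + (\<Sum>i<k. G (ws ! i))"
      if "length ws = k" "sum_list ws = - of_int a" "\<And>i. i < k \<Longrightarrow> e (ws ! i) = r * zs ! i"
      for ws and r :: real
    proof -
      have "of_real r * sum_list zs = (\<Sum>i<k. r * zs ! i)"
        by (simp add: sum_list_sum_nth sum_distrib_left k_def atLeast0LessThan)
      also have "\<dots> = (\<Sum>i<k. e (ws ! i))" using that by simp
      also have "\<dots> = sum_list ws + of_nat k * of_int (coeff P (m - 1)) / of_nat m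
        + (\<Sum>i<k. G (ws ! i))"
        by (simp add: e_def sum.distrib sum_list_sum_nth that(1) atLeast0LessThan)
      finally show ?thesis using that by simp
    qed
    note sx = sum_eq[OF xs(1,4,5)] and sy = sum_eq[OF ys(1,4,5)]
    have km: "real k * \<epsilon> \<le> real m * \<epsilon>" using k \<epsilon> by simp
    \<comment> \<open>Otherwise \<open>sx\<close>, multiplied by m, equates an integer with a
      quantity of size at most m^2 \<epsilon>, hence at most 1/2. So the integer is 0, against
      \<open>nd\<close>.\<close>
    have nz: "sum_list zs \<noteq> 0"
    proof
      assume "sum_list zs = 0"
      then have "of_int (a * m - k * coeff P (m - 1)) = of_nat m * (\<Sum>i<k. G (xs ! i))"
        using sx m by (simp add: field_simps)
      then have "\<bar>real_of_int (a * m - k * coeff P (m - 1))\<bar> = m * norm (\<Sum>i<k. G (xs ! i))"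
        by (metis norm_mult norm_of_int norm_of_nat)
      also have "\<dots> \<le> m * (\<Sum>i<k. \<epsilon>)"
        using G(2) xs(2) by (intro mult_left_mono sum_norm_le) auto
      also have "\<dots> \<le> m * (m * \<epsilon>)" using km by (simp add: mult_left_mono)
      also have "\<dots> \<le> 1 / 2" using \<epsilon>(4) m by (simp add: field_simps power2_eq_square)
      finally have "a * m = k * coeff P (m - 1)" by linarith
      then show False using nd[of k] k by (metis dvd_triv_right m_def)
    qed
    define r where "r = \<bar>s t - s t'\<bar>"
    \<comment> \<open>The roots differ by (s t - s t') times a root of unity, up to a variation of G
      that is at most half of their distance.\<close>
    have dist: "norm (xs ! i - ys ! i) \<le> 2 * r" if "i < k" for i
    proof -
      have "zs ! i \<in> U" using k that by (auto simp: L_def k_def)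
      then have "(zs ! i) ^ (2 * m) = 1" by (simp add: U_def)
      then have z1: "norm (zs ! i) = 1" using m by (auto dest: power_eq_1_iff)
      have "xs ! i - ys ! i = (e (xs ! i) - e (ys ! i)) - (G (xs ! i) - G (ys ! i))"
        by (simp add: e_def)
      also have "e (xs ! i) - e (ys ! i) = of_real (s t - s t') * zs ! i"
        using xs(5) ys(5) that by (simp add: algebra_simps)
      finally have "norm (xs ! i - ys ! i) \<le> norm (of_real (s t - s t') * zs ! i) + norm (G (xs ! i) - G (ys ! i))"
        by (metis norm_triangle_ineq4)
      also have "norm (of_real (s t - s t') * zs ! i) = r"
        unfolding norm_mult z1 norm_of_real r_def by simp
      also have "norm (G (xs ! i) - G (ys ! i)) \<le> \<epsilon> * norm (xs ! i - ys ! i)"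
        using G(3) xs(2) ys(2) that by blast
      also have "\<dots> \<le> 1/2 * norm (xs ! i - ys ! i)" using \<epsilon> by (intro mult_right_mono) auto
      finally show ?thesis by simp
    qed
    \<comment> \<open>Subtracting \<open>sy\<close> from \<open>sx\<close> cancels the trace and the
      constant. What remains gives r \<delta> \<le> r \<delta>/2, hence r = 0.\<close>
    have "r * norm (sum_list zs) = norm (of_real (s t - s t') * sum_list zs)"
      unfolding norm_mult norm_of_real r_def by simp
    also have "of_real (s t - s t') * sum_list zs = (\<Sum>i<k. G (xs ! i) - G (ys ! i))"
      using sx sy by (simp add: left_diff_distrib sum_subtractf)
    also have "norm \<dots> \<le> (\<Sum>i<k. \<epsilon> * (2 * r))"
    proof (intro sum_norm_le)
      fix i assume "i \<in> {..<k}"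
      then have "norm (G (xs ! i) - G (ys ! i)) \<le> \<epsilon> * norm (xs ! i - ys ! i)"
        using G(3) xs(2) ys(2) by blast
      also have "\<dots> \<le> \<epsilon> * (2 * r)" using dist[of i] \<epsilon> \<open>i \<in> {..<k}\<close> by (intro mult_left_mono) auto
      finally show "norm (G (xs ! i) - G (ys ! i)) \<le> \<epsilon> * (2 * r)" .
    qed
    also have "\<dots> = (real k * \<epsilon>) * (2 * r)" by simp
    also have "\<dots> \<le> (real m * \<epsilon>) * (2 * r)" by (rule mult_right_mono[OF km]) (simp add: r_def)
    also have "\<dots> \<le> \<delta> / 4 * (2 * r)" using \<epsilon>(3) m by (intro mult_right_mono) (auto simp: r_def field_simps)
    finally have "r * norm (sum_list zs) \<le> \<delta> / 2 * r" by simp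
    moreover have "r * \<delta> \<le> r * norm (sum_list zs)"
      using \<delta>_le[OF k(3) nz] by (intro mult_left_mono) (auto simp: r_def)
    ultimately have "r * \<delta> \<le> 0" by (simp add: mult.commute)
    then have "s t = s t'" using \<delta> by (auto simp: r_def mult_le_0_iff)
    \<comment> \<open>Equality of \<open>s\<close> only gives |t| = |t'|. The sign is recovered from
      a root, because both sides use the same root of unity.\<close>
    then have "e (xs ! 0) ^ m = e (ys ! 0) ^ m" using xs(5) ys(5) k by simp
    then have "(of_int t :: complex) = of_int t'"
      using G(1) xs(2,3) ys(2,3) k by (simp add: e_def)
    then show ?thesis by simp
  qed
  show ?thesis
  proof (rule that)
    fix A and B :: nat
    assume A: "A = {t. M1 < \<bar>of_int t\<bar> \<and> (\<exists>g h. P - [:t:] = g * h \<and> lead_coeff g = 1 \<and>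
               0 < degree g \<and> degree g < degree P \<and> \<bar>coeff g (degree g - 1)\<bar> \<le> int B)}"
    have "\<exists>a zs. a \<in> {- int B..int B} \<and> zs \<in> L \<and> data t a zs" if tA: "t \<in> A" for t
    proof -
      obtain g h where t: "M1 < \<bar>of_int t\<bar>" and gh: "P - [:t:] = g * h" "lead_coeff g = 1"
        "0 < degree g" "degree g < m" "\<bar>coeff g (degree g - 1)\<bar> \<le> int B"
        using tA unfolding A m_def by blast
      let ?g = "map_poly of_int g :: complex poly"
      have dg: "degree ?g = degree g" by (simp add: degree_map_poly)
      obtain xs where xs: "length xs = degree g" "\<And>x. x \<in> set xs \<Longrightarrow> poly ?g x = 0"
        "sum_list xs = - of_int (coeff g (degree g - 1))"
        using monic_complex_poly_roots[of ?g] gh(2,3) by (auto simp: dg coeff_map_poly)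
      have root: "poly Pc x = of_int t" if "x \<in> set xs" for x
      proof -
        have "Pc - [:of_int t:] = map_poly of_int (P - [:t:])"
          by (rule poly_eqI) (auto simp: Pc_def coeff_map_poly coeff_pCons split: nat.split)
        then have "poly (Pc - [:of_int t:]) x = poly (?g * map_poly of_int h) x"
          by (simp add: gh(1) of_int_poly_mult)
        then show ?thesis using xs(2)[OF that] by simp
      qed
      have large: "norm x > M0" if "x \<in> set xs" for x
        using M1(2)[of x] root[OF that] t by (force simp: not_less)
      have st: "s t > 0" "s t ^ m = \<bar>of_int t\<bar>" using t M1 m by (auto simp: s_def)
      define zs where "zs = map (\<lambda>x. e x / s t) xs"
      have "zs \<in> L"
      proof -
        have "(e x / s t) ^ (2 * m) = 1" if "x \<in> set xs" for x
        proof -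
          have "(e x / s t) ^ (2 * m) = ((e x) ^ m) ^ 2 / of_real (s t ^ m) ^ 2"
            by (simp add: power_divide power_mult mult.commute)
          also have "\<dots> = of_int t ^ 2 / of_real \<bar>of_int t\<bar> ^ 2"
            using G(1)[OF large[OF that]] root[OF that] st by (simp add: e_def)
          also have "\<dots> = of_int t ^ 2 / of_int t ^ 2"
            by (metis of_real_of_int_eq of_real_power power2_abs)
          finally show ?thesis using t M1 by auto
        qed
        then show ?thesis using xs(1) gh(4) by (auto simp: L_def U_def zs_def)
      qed
      moreover have "data t (coeff g (degree g - 1)) zs"
        unfolding data_def
        by (rule exI[of _ xs]) (use st xs gh root large \<open>zs \<in> L\<close> in \<open>auto simp: zs_def\<close>)
      moreover have "coeff g (degree g - 1) \<in> {- int B..int B}" using gh(5) by auto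
      ultimately show ?thesis by blast
    qed
    then obtain a zs where az: "\<And>t. t \<in> A \<Longrightarrow> a t \<in> {- int B..int B} \<and> zs t \<in> L \<and> data t (a t) (zs t)"
      by metis
    have inj: "inj_on (\<lambda>t. (zs t, a t)) A"
      by (rule inj_onI) (metis az uniq prod.inject)
    have sub: "(\<lambda>t. (zs t, a t)) ` A \<subseteq> L \<times> {- int B..int B}" using az by auto
    have fin: "finite (L \<times> {- int B..int B})" using finL by simp
    have "card A \<le> card (L \<times> {- int B..int B})" by (rule card_inj_on_le[OF inj sub fin])
    also have "\<dots> = card L * (2 * B + 1)" by (simp add: card_cartesian_product nat_add_distrib nat_mult_distrib algebra_simps)
    finally show "finite A \<and> card A \<le> card L * (2 * B + 1)"
      using inj_on_finite[OF inj sub fin] by simp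
  qed
qed

subsection \<open>Cyclotomic polynomials of prime index\<close>

lemma cyclotomic_1: "cyclotomic 1 = [:-1, 1:]"
proof -
  have "cyclotomic 1 = [:-1, 1:] div 1"
    by (subst cyclotomic.simps) (simp add: monom_altdef one_pCons)
  then show ?thesis by simp
qed

lemma cyclotomic_prime:
  assumes "prime l"
  shows "cyclotomic l = (\<Sum>i<l. monom 1 i)"
proof -
  have l: "l > 1" using assms prime_gt_1_nat by blast
  have "filter (\<lambda>d. d dvd l) [1..<l] = filter (\<lambda>d. d dvd l) (1 # [2..<l])"
    using l by (simp add: upt_conv_Cons numeral_2_eq_2)
  also have "\<dots> = 1 # filter (\<lambda>d. False) [2..<l]"
    using assms by (auto simp: prime_nat_iff simp del: filter_False intro!: filter_cong)
  finally have "prod_list (map cyclotomic (filter (\<lambda>d. d dvd l) [1..<l])) = [:-1, 1:]"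
    by (simp flip: cyclotomic_1)
  then have "cyclotomic l = (monom 1 l - 1) div [:-1, 1:]"
    using l by (subst cyclotomic.simps) simp
  also have "(monom 1 l - 1 :: int poly) = [:-1, 1:] * (\<Sum>i<l. monom 1 i)"
    using power_diff_1_eq[of "monom (1::int) 1" l] 
    by (simp add: monom_power one_pCons monom_altdef)
  finally show ?thesis by (simp del: mult_pCons_left)
qed

lemma coeff_cyclotomic_prime:
  "prime l \<Longrightarrow> coeff (cyclotomic l) i = (if i < l then 1 else 0)"
  by (simp add: cyclotomic_prime coeff_sum)

lemma degree_cyclotomic_prime: "prime l \<Longrightarrow> degree (cyclotomic l) = l - 1"
  using prime_gt_0_nat[of l]
  by (intro antisym degree_le le_degree) (auto simp: coeff_cyclotomic_prime)

lemma poly_cyclotomic_prime: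
  "prime l \<Longrightarrow> poly (cyclotomic l) x = (\<Sum>i<l. x ^ i)"
  by (simp add: cyclotomic_prime poly_sum poly_monom)

text \<open>Eisenstein at \<open>l\<close> for Phi_l(X + 1): from X Phi_l(X + 1) = (X + 1)^l - 1 its
  coefficients are binomial coefficients, all but the leading one divisible by \<open>l\<close>. A
  factorization would make l^2 divide the constant coefficient, which is \<open>l\<close>.\<close>

lemma cyclotomic_prime_no_factorization:
  assumes l: "prime l" and gh: "cyclotomic l = g * h"
    and monic: "lead_coeff g = 1" "lead_coeff h = 1" and deg: "degree g > 0" "degree h > 0"
  shows False
proof -
  define sh :: "int poly" where "sh = [:1, 1:]"
  define G where "G = g \<circ>\<^sub>p sh"
  define H where "H = h \<circ>\<^sub>p sh"
  have lc: "lead_coeff G = 1" "lead_coeff H = 1"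
    using monic by (simp_all add: G_def H_def sh_def lead_coeff_comp)
  have dG: "degree G = degree g" "degree H = degree h" by (simp_all add: G_def H_def sh_def degree_pcompose)
  have l1: "l > 1" using l prime_gt_1_nat by blast
  have deg_sum: "degree G + degree H = l - 1"
    using deg degree_cyclotomic_prime[OF l] by (simp add: gh dG degree_mult_eq_0 degree_mult_eq) (metis degree_0 degree_mult_eq less_numeral_extra(3))
  have GH: "G * H = cyclotomic l \<circ>\<^sub>p sh" by (simp add: gh G_def H_def pcompose_mult)
  have X: "monom 1 1 * (G * H) = sh ^ l - 1"
  proof (rule iffD1[OF poly_eq_poly_eq_iff], rule ext)
    fix x :: int
    show "poly (monom 1 1 * (G * H)) x = poly (sh ^ l - 1) x"
      using power_diff_1_eq[of "1 + x" l]
      by (simp add: GH poly_monom poly_pcompose poly_cyclotomic_prime[OF l] sh_def poly_power)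
  qed
  have cf: "coeff (G * H) i = int (l choose (Suc i))" for i
  proof -
    have "coeff (G * H) i = coeff (monom 1 1 * (G * H)) (Suc i)" by (simp add: coeff_monom_mult)
    also have "\<dots> = int (l choose (Suc i))"
      unfolding X sh_def by (cases "Suc i \<le> l")
        (simp_all add: coeff_linear_poly_power coeff_eq_0 degree_power_eq)
    finally show ?thesis .
  qed
  have "int l dvd coeff (G * H) i" if "i < l - 1" for i
  proof -
    \<comment> \<open>The prime \<open>l\<close> divides the product on the right but not
      \<open>Suc i\<close>, so it divides the binomial coefficient.\<close>
    have "Suc (l - 1) * (l - 1 choose i) = (Suc (l - 1) choose Suc i) * Suc i"
      by (rule Suc_times_binomial_eq)
    then have "l dvd (l choose Suc i) * Suc i" using l1 by (metis Suc_diff_1 dvd_triv_left less_trans zero_less_one)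
    moreover have "\<not> l dvd Suc i" using that by (auto dest: dvd_imp_le)
    ultimately show ?thesis using l unfolding cf by (simp add: prime_dvd_mult_iff del: mult_Suc_right)
  qed
  then have "int l dvd coeff H 0" "int l dvd coeff G 0"
    using eisenstein_constant_coeffs[of "int l" G H] eisenstein_constant_coeffs[of "int l" H G]
      l lc deg dG deg_sum by (auto simp: mult.commute add.commute)
  then have "int l * int l dvd coeff (G * H) 0" by (simp add: coeff_mult_0 mult_dvd_mono mult.commute)
  then show False using l1 unfolding cf by (simp flip: of_nat_mult)
qed

text \<open>For larger x the top power dominates: the lower terms sum to less than half of
  |x|^(l-1), and the assumed bound on the whole sum is at most the other half. This bounds the roots
  of Phi_l - t.\<close>

lemma norm_le_of_geometric_sum_le:
  fixes x :: complex and y :: real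
  assumes l: "l \<ge> 2" and y: "y \<ge> 1" and le: "norm (\<Sum>i<l. x ^ i) \<le> l * y ^ (l - 1)"
  shows "norm x \<le> 2 * real l * y"
proof (rule ccontr)
  assume "\<not> norm x \<le> 2 * real l * y"
  then have r: "norm x > 2 * real l * y" by simp
  obtain k where k: "l = k + 2" using l by (metis add.commute le_iff_add)
  have "2 * real l * 1 \<le> 2 * real l * y" using y by (intro mult_left_mono) auto
  then have rl: "norm x \<ge> 2 * real l" using r by simp
  then have "norm x \<ge> 1" using l by simp
  note rl = rl this
  have "x ^ (k + 1) = (\<Sum>i<l. x ^ i) - (\<Sum>i<k + 1. x ^ i)" by (simp add: k)
  then have "norm x ^ (k + 1) \<le> norm (\<Sum>i<l. x ^ i) + norm (\<Sum>i<k + 1. x ^ i)"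
    by (metis norm_power norm_triangle_ineq4)
  also have "\<dots> \<le> l * y ^ (k + 1) + (\<Sum>i<k + 1. norm x ^ k)"
  proof (intro add_mono sum_norm_le)
    have "l - 1 = k + 1" by (simp add: k)
    then show "norm (\<Sum>i<l. x ^ i) \<le> l * y ^ (k + 1)" using le by (simp only:)
  qed (use rl(2) in \<open>auto simp: norm_power intro!: power_increasing\<close>)
  also have "l * y ^ (k + 1) \<le> l * (norm x / (2 * l)) ^ (k + 1)"
    using r y l by (intro mult_left_mono power_mono) (auto simp: field_simps)
  also have "\<dots> = norm x ^ (k + 1) / 2 * (1 / (2 * l) ^ k)"
    using l by (simp add: power_divide field_simps)
  also have "\<dots> \<le> norm x ^ (k + 1) / 2 * 1"
    using one_le_power[of "2 * real l" k] l
    by (intro mult_left_mono) (simp_all add: divide_le_eq_1 not_less del: power_mult_distrib)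
  also have "(\<Sum>i<k + 1. norm x ^ k) < norm x ^ (k + 1) / 2"
  proof -
    have "2 * real (k + 1) < norm x" using rl k by simp
    then have "2 * real (k + 1) * norm x ^ k < norm x * norm x ^ k"
      using rl(2) by (intro mult_strict_right_mono zero_less_power) auto
    then show ?thesis by (simp add: algebra_simps)
  qed
  finally show False by simp
qed

subsection \<open>Counting the primes\<close>

lemma prod_distinct_primes_dvd:
  fixes n :: nat
  assumes "finite A" "\<And>p. p \<in> A \<Longrightarrow> prime p \<and> p dvd n"
  shows "\<Prod>A dvd n"
  using assms
proof (induction A rule: finite_induct)
  case (insert p A)
  have "coprime p (\<Prod>A)"
    using insert by (intro prod_coprime_right primes_coprime) auto
  then show ?case using insert by (simp add: divides_mult)
qed simp

text \<open>The product of these distinct primes divides \<open>t\<close> and is at least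
  \<open>z\<close> to the power of their number.\<close>

lemma card_large_prime_divisors_le:
  fixes t :: int and z :: real
  assumes "t \<noteq> 0" "z > 1" "\<bar>of_int t\<bar> \<le> z ^ k"
  shows "finite {p::nat. prime p \<and> z < p \<and> int p dvd t}"
    and "card {p::nat. prime p \<and> z < p \<and> int p dvd t} \<le> k"
proof -
  let ?A = "{p::nat. prime p \<and> z < p \<and> int p dvd t}"
  have A: "p \<in> ?A \<longleftrightarrow> prime p \<and> z < p \<and> p dvd nat \<bar>t\<bar>" for p
    by (simp add: int_dvd_int_iff[symmetric])
  have t: "nat \<bar>t\<bar> > 0" using assms(1) by simp
  have "?A \<subseteq> {..nat \<bar>t\<bar>}" using A dvd_imp_le[OF _ t] by blast
  then show fin: "finite ?A" using finite_subset by blast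
  have "\<Prod>?A dvd nat \<bar>t\<bar>"
    using A fin by (intro prod_distinct_primes_dvd) auto
  then have "\<Prod>?A \<le> nat \<bar>t\<bar>" using t by (rule dvd_imp_le)
  have "z ^ card ?A = (\<Prod>p\<in>?A. z)" by simp
  also have "\<dots> \<le> (\<Prod>p\<in>?A. real p)" using assms(2) by (intro prod_mono) auto
  also have "\<dots> = real (\<Prod>?A)" by simp
  also have "\<dots> \<le> real (nat \<bar>t\<bar>)" using \<open>\<Prod>?A \<le> nat \<bar>t\<bar>\<close> of_nat_mono by blast
  also have "\<dots> \<le> z ^ k" using assms(3) by simp
  finally show "card ?A \<le> k" using assms(2) by (simp add: power_le_imp_le_exp)
qed

text \<open>Here \<open>t\<close> is the multiple of \<open>p\<close> that witnesses
  non-essentiality. It is nonzero because Phi_l itself does not factor. Its size is at most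
  Phi_l(y), so the roots of \<open>g\<close> have size at most 2ly, and there are fewer than
  \<open>l\<close> of them.\<close>

lemma not_essential_factorization:
  assumes l: "prime l" "odd l" and p: "prime p" and ne: "\<not> essential l p"
  defines "y \<equiv> real p powr (2 / l)"
  obtains t g h where "t \<noteq> 0" "int p dvd t" "\<bar>of_int t\<bar> \<le> l * y ^ (l - 1)"
    "cyclotomic l - [:t:] = g * h" "lead_coeff g = 1" "0 < degree g" "degree g < l - 1"
    "\<bar>real_of_int (coeff g (degree g - 1))\<bar> \<le> 2 * real l ^ 2 * y"
proof -
  have l3: "l \<ge> 3" using l prime_ge_2_nat[OF l(1)] by (cases "l = 2") auto
  have p1: "p \<ge> 1" using p prime_ge_1_nat by blast
  have y: "y \<ge> 1" unfolding y_def using p1 by (intro ge_one_powr_ge_zero) auto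
  obtain c where c: "\<bar>real_of_int (c * int p)\<bar> < poly (map_poly real_of_int (cyclotomic l)) y"
    and red: "\<not> irreducible (map_poly rat_of_int (cyclotomic l - [:c * int p:]))"
    using ne unfolding essential_def y_def by (auto simp: abs_mult)
  define t where "t = c * int p"
  let ?Q = "cyclotomic l - [:t:]"
  have coeffQ: "coeff ?Q i = (if i < l then 1 else 0)" if "i > 0" for i
    using that by (simp add: coeff_cyclotomic_prime[OF l(1)] coeff_pCons split: nat.split)
  have degQ: "degree ?Q = l - 1"
    using l3 coeffQ by (intro antisym degree_le le_degree) auto
  have lcQ: "lead_coeff ?Q = 1" using coeffQ[of "l - 1"] l3 by (simp add: degQ)
  obtain g h where gh: "?Q = g * h" "lead_coeff g = 1" "lead_coeff h = 1" "0 < degree g" "0 < degree h"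
  proof (rule monic_int_factorization[OF lcQ])
    show "degree ?Q > 0" using l3 degQ by simp
    show "\<not> irreducible (map_poly rat_of_int ?Q)" using red unfolding t_def .
  qed
  have "degree g + degree h = l - 1"
    using gh degQ by (metis degree_0 degree_mult_eq less_numeral_extra(3))
  then have dg: "degree g < l - 1" using gh by simp
  have t0: "t \<noteq> 0" using cyclotomic_prime_no_factorization[OF l(1), of g h] gh by auto
  have "poly (map_poly real_of_int (cyclotomic l)) y = (\<Sum>i<l. y ^ i)"
    by (simp add: poly_altdef degree_map_poly degree_cyclotomic_prime[OF l(1)] coeff_map_poly
        coeff_cyclotomic_prime[OF l(1)]) (rule sum.cong, use l3 in auto)
  also have "\<dots> \<le> (\<Sum>i<l. y ^ (l - 1))" using y by (intro sum_mono power_increasing) auto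
  finally have t_le: "\<bar>of_int t\<bar> \<le> l * y ^ (l - 1)" using c by (simp add: t_def)
  let ?g = "map_poly of_int g :: complex poly"
  have deg_g: "degree ?g = degree g" by (simp add: degree_map_poly)
  obtain xs where xs: "length xs = degree g" "\<And>x. x \<in> set xs \<Longrightarrow> poly ?g x = 0"
    "sum_list xs = - of_int (coeff g (degree g - 1))"
    using monic_complex_poly_roots[of ?g] gh(2,4) by (auto simp: deg_g coeff_map_poly)
  have root_le: "norm x \<le> 2 * real l * y" if "x \<in> set xs" for x
  proof (rule norm_le_of_geometric_sum_le)
    have "poly (map_poly of_int ?Q) x = poly (?g * map_poly of_int h) x"
      by (simp add: gh(1) of_int_poly_mult)
    moreover have "map_poly complex_of_int ?Q = (\<Sum>i<l. monom 1 i) - [:of_int t:]"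
      by (rule poly_eqI) (auto simp: coeff_map_poly coeff_sum coeff_cyclotomic_prime[OF l(1)] coeff_pCons split: nat.split)
    ultimately have "(\<Sum>i<l. x ^ i) = of_int t" using xs(2)[OF that] by (simp add: poly_sum poly_monom)
    then show "norm (\<Sum>i<l. x ^ i) \<le> l * y ^ (l - 1)" using t_le by simp
  qed (use l3 y in auto)
  have "\<bar>real_of_int (coeff g (degree g - 1))\<bar> = norm (sum_list xs)" by (simp add: xs(3))
  also have "\<dots> \<le> (\<Sum>i<degree g. 2 * real l * y)"
    unfolding sum_list_sum_nth xs(1) atLeast0LessThan using root_le xs(1) by (intro sum_norm_le) simp
  also have "\<dots> \<le> l * (2 * real l * y)" using dg y by (simp add: mult_right_mono)
  finally show ?thesis
    using that[of t g h] t0 t_le gh dg by (simp add: t_def power2_eq_square mult_ac)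
qed

text \<open>The least \<open>d\<close> is at most \<open>T\<close> as soon as some \<open>d\<close>
  is, and membership in \<open>PP\<close> follows since \<open>p\<close> divides
  \<open>p ^ i\<close>.\<close>

lemma mem_S_iff:
  assumes "T \<ge> 0" "i > 0"
  shows "p \<in> S i l T \<longleftrightarrow> prime p \<and>
           (\<exists>d\<ge>1. real d \<le> T \<and> int p ^ i dvd poly (cyclotomic l) (int d))"
proof -
  let ?Q = "\<lambda>d. d \<ge> 1 \<and> int (p ^ i) dvd poly (cyclotomic l) (int d)"
  have "real (Least ?Q) \<le> T \<longleftrightarrow> (\<exists>d. ?Q d \<and> real d \<le> T)" if "\<exists>d. ?Q d"
    using LeastI_ex[OF that] Least_le[of ?Q] by (meson of_nat_le_iff order_trans)
  moreover have "p \<in> PP l" if "?Q d" "prime p" for d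
    using that assms(2) unfolding PP_def by (auto intro: dvd_trans[OF dvd_power])
  ultimately show ?thesis unfolding S_def R_def PP_def
    by (auto split: if_splits)
qed

lemma S_prime_power_le:
  assumes l: "prime l" and T: "T \<ge> 1" and p: "p \<in> S i l T" and i: "i > 0"
  shows "real p ^ i \<le> l * T ^ (l - 1)"
proof -
  obtain d where d: "d \<ge> 1" "real d \<le> T" "int p ^ i dvd poly (cyclotomic l) (int d)"
    using p mem_S_iff[of T i p l] T i by auto
  have l1: "l > 0" using l prime_gt_0_nat by blast
  have P: "poly (cyclotomic l) (int d) = (\<Sum>j<l. int d ^ j)" by (rule poly_cyclotomic_prime[OF l])
  \<comment> \<open>The constant term makes the value positive, so that a divisor of it cannot
    exceed it.\<close>
  have "int d ^ 0 \<le> (\<Sum>j<l. int d ^ j)" using l1 by (intro member_le_sum) auto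
  then have "int p ^ i \<le> (\<Sum>j<l. int d ^ j)" using d(3) unfolding P by (intro zdvd_imp_le) auto
  then have "real_of_int (int p ^ i) \<le> real_of_int (\<Sum>j<l. int d ^ j)" by (rule of_int_le_iff[THEN iffD2])
  then have "real p ^ i \<le> (\<Sum>j<l. real d ^ j)" by simp
  also have "\<dots> \<le> (\<Sum>j<l. T ^ (l - 1))"
    using d T by (intro sum_mono order_trans[OF power_mono power_increasing]) auto
  finally show ?thesis by simp
qed

text \<open>Needed for comparing cardinalities, as \<open>card\<close> is 0 on infinite
  sets.\<close>

lemma finite_S:
  assumes "prime l" "T \<ge> 1" "i > 0"
  shows "finite (S i l T)"
proof (rule finite_subset)
  show "S i l T \<subseteq> {..nat \<lfloor>l * T ^ (l - 1)\<rfloor>}"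
  proof
    fix p assume p: "p \<in> S i l T"
    then have "prime p" by (simp add: S_def PP_def)
    then have "real p ^ 1 \<le> real p ^ i" using assms(3) prime_ge_1_nat by (intro power_increasing) auto
    also note S_prime_power_le[OF assms(1,2) p assms(3)]
    finally have "real p \<le> l * T ^ (l - 1)" by simp
    then show "p \<in> {..nat \<lfloor>l * T ^ (l - 1)\<rfloor>}" using le_nat_floor by blast
  qed
qed simp

lemma S2_subset_S1: "T \<ge> 0 \<Longrightarrow> S 2 l T \<subseteq> S 1 l T"
  by (simp add: mem_S_iff power2_eq_square subset_iff) (blast dest: dvd_mult_left)

text \<open>With z = \<open>sqrt T\<close>, the primes up to z give the first term. Every other one
  divides some \<open>t\<close> whose factor has trace of size O(T^(1-1/l)). There are O(T^(1-1/l) +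
  1) such \<open>t\<close>, and each has at most 2l prime divisors above z because |t| \<le> T^l =
  z^(2l).\<close>

lemma card_not_essential_le:
  assumes l: "prime l" "odd l"
  obtains C T0 :: real where "\<And>T. T \<ge> T0 \<Longrightarrow>
    card {p \<in> S 2 l T. \<not> essential l p} \<le> sqrt T + C * (T powr (1 - 1 / l) + 1)"
proof -
  have l3: "l \<ge> 3" using l prime_ge_2_nat[OF l(1)] by (cases "l = 2") auto
  have deg: "degree (cyclotomic l) = l - 1" by (rule degree_cyclotomic_prime[OF l(1)])
  \<comment> \<open>The factor 1 is the coefficient of Phi_l below the leading one.\<close>
  have "\<not> int (l - 1) dvd int k * 1" if "0 < k" "k < l - 1" for k
    using that by (auto dest: zdvd_imp_le)
  then obtain M :: real and C :: nat where MC: "\<And>A B. A = {t. M < \<bar>of_int t\<bar> \<and> (\<exists>g h. cyclotomic l - [:t:] = g * h \<and>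
      lead_coeff g = 1 \<and> 0 < degree g \<and> degree g < degree (cyclotomic l) \<and> \<bar>coeff g (degree g - 1)\<bar> \<le> int B)} \<Longrightarrow>
             finite A \<and> card A \<le> C * (2 * B + 1)"
    using card_reducible_translates_le[of "cyclotomic l"] l3
    unfolding deg by (auto simp: coeff_cyclotomic_prime[OF l(1)])
  \<comment> \<open>The three bounds give z > 1, then |t| \<ge> p > z \<ge> M, and finally l^l
    T^(l-1) \<le> T^l.\<close>
  define T0 where "T0 = max (max 2 (M ^ 2)) (real l ^ l)"
  show ?thesis
  proof (rule that)
    fix T assume "T \<ge> T0"
    then have T: "T \<ge> 2" "T \<ge> M ^ 2" "T \<ge> real l ^ l" by (auto simp: T0_def)
    define z where "z = sqrt T"
    have z: "z > 1" "z \<ge> M" "z ^ 2 = T" using T by (auto simp: z_def real_le_rsqrt)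
    define Y where "Y = l * T powr (1 - 1 / l)"
    define B where "B = nat \<lfloor>2 * real l ^ 2 * Y\<rfloor>"
    define A where "A = {t. M < \<bar>real_of_int t\<bar> \<and> (\<exists>g h. cyclotomic l - [:t:] = g * h \<and>
      lead_coeff g = 1 \<and> 0 < degree g \<and> degree g < degree (cyclotomic l) \<and> \<bar>coeff g (degree g - 1)\<bar> \<le> int B)}"
    define A' where "A' = {t \<in> A. t \<noteq> 0 \<and> \<bar>of_int t\<bar> \<le> z ^ (2 * l)}"
    have A: "finite A" "card A \<le> C * (2 * B + 1)" using MC[OF A_def] by auto
    then have A': "finite A'" "card A' \<le> C * (2 * B + 1)"
      using card_mono[of A A'] by (auto simp: A'_def)
    have cover: "p \<in> (\<Union>t\<in>A'. {p::nat. prime p \<and> z < p \<and> int p dvd t})"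
      if p: "p \<in> S 2 l T" "\<not> essential l p" "z < p" for p
    proof -
      have pr: "prime p" using p(1) by (simp add: S_def PP_def)
      define y where "y = real p powr (2 / l)"
      obtain t g h where t: "t \<noteq> 0" "int p dvd t" "\<bar>of_int t\<bar> \<le> l * y ^ (l - 1)"
        and gh: "cyclotomic l - [:t:] = g * h" "lead_coeff g = 1" "0 < degree g" "degree g < l - 1"
          "\<bar>real_of_int (coeff g (degree g - 1))\<bar> \<le> 2 * real l ^ 2 * y"
        by (rule not_essential_factorization[OF l pr p(2), folded y_def])
      \<comment> \<open>The exponent 2 of \<open>S 2\<close> enters here: p^2 = y^l is at most l
        T^(l-1), which saves the factor T^(1/l) in the bound for the trace.\<close>
      have "y = (real p ^ 2) powr (1 / l)"
        using prime_gt_0_nat[OF pr] by (simp add: y_def powr_powr flip: powr_numeral)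
      also have "\<dots> \<le> (l * T ^ (l - 1)) powr (1 / l)"
        using S_prime_power_le[OF l(1) _ p(1)] T by (intro powr_mono2) auto
      also have "\<dots> = real l powr (1 / l) * T powr (1 - 1 / l)"
        using T l3 by (simp add: powr_mult powr_powr of_nat_diff field_simps flip: powr_realpow)
      also have "\<dots> \<le> real l powr 1 * T powr (1 - 1 / l)"
        using l3 by (intro mult_right_mono powr_mono) auto
      finally have yY: "y \<le> Y" by (simp add: Y_def)
      \<comment> \<open>For the size of \<open>t\<close> the crude bound y \<le> l T suffices, since
        only its number of large prime factors matters.\<close>
      have "T powr (1 - 1 / l) \<le> T powr 1" using T by (intro powr_mono) auto
      then have "Y \<le> l * T" using T by (simp add: Y_def mult_left_mono)
      then have "l * y ^ (l - 1) \<le> l * (l * T) ^ (l - 1)"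
        using yY by (intro mult_left_mono power_mono) (auto simp: y_def)
      also have "\<dots> = real l ^ l * T ^ (l - 1)"
        using l3 by (cases l) (simp_all add: power_mult_distrib)
      also have "\<dots> \<le> T * T ^ (l - 1)" using T by (intro mult_right_mono) auto
      also have "\<dots> = z ^ (2 * l)" using l3 by (cases l) (simp_all add: power_mult z(3) flip: power2_eq_square)
      finally have tz: "\<bar>of_int t\<bar> \<le> z ^ (2 * l)" using t(3) by linarith
      have "int p \<le> \<bar>t\<bar>" using t(1,2) by (simp add: zdvd_imp_le)
      then have "real p \<le> \<bar>of_int t\<bar>" by linarith
      then have "M < \<bar>of_int t\<bar>" using z p(3) by linarith
      moreover have "2 * real l ^ 2 * y \<le> 2 * real l ^ 2 * Y" using yY by (intro mult_left_mono) auto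
      then have "\<bar>coeff g (degree g - 1)\<bar> \<le> int B" using gh(5) unfolding B_def by linarith
      ultimately have "t \<in> A'" using gh t tz unfolding A'_def A_def deg by blast
      then show ?thesis using pr p(3) t(2) by blast
    qed
    have sub: "{p \<in> S 2 l T. \<not> essential l p} \<subseteq>
      {1..nat \<lfloor>z\<rfloor>} \<union> (\<Union>t\<in>A'. {p::nat. prime p \<and> z < p \<and> int p dvd t})"
    proof
      fix p assume p: "p \<in> {p \<in> S 2 l T. \<not> essential l p}"
      then have "p \<ge> 1" using prime_ge_1_nat by (simp add: S_def PP_def)
      then have "p \<in> {1..nat \<lfloor>z\<rfloor>}" if "real p \<le> z" using that le_nat_floor by auto
      then show "p \<in> {1..nat \<lfloor>z\<rfloor>} \<union> (\<Union>t\<in>A'. {p::nat. prime p \<and> z < p \<and> int p dvd t})"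
        using cover[of p] p by (cases "real p \<le> z") auto
    qed
    have fin: "finite (\<Union>t\<in>A'. {p::nat. prime p \<and> z < p \<and> int p dvd t})"
      using A'(1) card_large_prime_divisors_le(1)[OF _ z(1)] by (auto simp: A'_def)
    have "card (\<Union>t\<in>A'. {p::nat. prime p \<and> z < p \<and> int p dvd t}) \<le>
        (\<Sum>t\<in>A'. card {p::nat. prime p \<and> z < p \<and> int p dvd t})"
      by (rule card_UN_le[OF A'(1)])
    also have "\<dots> \<le> (\<Sum>t\<in>A'. 2 * l)"
      using card_large_prime_divisors_le(2)[OF _ z(1)] by (intro sum_mono) (auto simp: A'_def)
    also have "\<dots> \<le> C * (2 * B + 1) * (2 * l)" using A'(2) by simp
    finally have "card {p \<in> S 2 l T. \<not> essential l p} \<le> nat \<lfloor>z\<rfloor> + C * (2 * B + 1) * (2 * l)"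
      using card_mono[OF _ sub] fin card_Un_le[of "{1..nat \<lfloor>z\<rfloor>}" "\<Union>t\<in>A'. {p::nat. prime p \<and> z < p \<and> int p dvd t}"]
      by simp
    then have "real (card {p \<in> S 2 l T. \<not> essential l p}) \<le> nat \<lfloor>z\<rfloor> + C * (2 * real B + 1) * (2 * l)"
      by (simp add: algebra_simps flip: of_nat_le_iff[where 'a = real])
    also have "\<dots> \<le> z + C * (2 * (2 * real l ^ 2 * Y) + 1) * (2 * l)"
    proof -
      have "real (nat \<lfloor>z\<rfloor>) \<le> z" using z by simp
      moreover have "real B \<le> 2 * real l ^ 2 * Y" unfolding B_def Y_def by simp
      ultimately show ?thesis by (intro add_mono mult_right_mono mult_left_mono) auto
    qed
    also have "\<dots> \<le> sqrt T + (C * (4 * real l ^ 3 + 1) * (2 * l)) * (T powr (1 - 1 / l) + 1)"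
    proof -
      have "2 * (2 * real l ^ 2 * Y) + 1 \<le> (4 * real l ^ 3 + 1) * (T powr (1 - 1 / l) + 1)"
        by (simp add: Y_def algebra_simps power3_eq_cube power2_eq_square)
      then have "C * (2 * (2 * real l ^ 2 * Y) + 1) * (2 * l) \<le> C * ((4 * real l ^ 3 + 1) * (T powr (1 - 1 / l) + 1)) * (2 * l)"
        by (intro mult_right_mono mult_left_mono) auto
      then show ?thesis by (simp add: z_def algebra_simps)
    qed
    finally show "card {p \<in> S 2 l T. \<not> essential l p} \<le>
      sqrt T + (C * (4 * real l ^ 3 + 1) * (2 * l)) * (T powr (1 - 1 / l) + 1)" .
  qed
qed

theorem theorem4:
  fixes l :: nat
  assumes "prime l" and "odd l"
    and "(\<lambda>T::real. real (card {p \<in> S 1 l T. essential l p})) \<in> o[at_top](\<lambda>T. T)"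
  shows "(\<lambda>T::real. real (card (S 2 l T))) \<in> o[at_top](\<lambda>T. T)"
proof -
  obtain C T0 :: real where C: "\<And>T. T \<ge> T0 \<Longrightarrow>
    card {p \<in> S 2 l T. \<not> essential l p} \<le> sqrt T + C * (T powr (1 - 1 / l) + 1)"
    by (rule card_not_essential_le[OF assms(1,2)]) (erule that)
  have l: "l > 0" using assms(1) prime_gt_0_nat by blast
  \<comment> \<open>The saving 1/l in the exponent makes the non-essential primes
    negligible.\<close>
  have "(\<lambda>T::real. T powr (1 - 1 / l)) \<in> o(\<lambda>T. T powr 1)"
    using l by (subst powr_smallo_iff) (auto simp: filterlim_ident)
  also have "(\<lambda>T::real. T powr 1) \<in> \<Theta>(\<lambda>T. T)" by real_asymp
  finally have "(\<lambda>T::real. C * (T powr (1 - 1 / l) + 1)) \<in> o(\<lambda>T. T)"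
    by (cases "C = 0") (auto intro!: sum_in_smallo, real_asymp)
  moreover have "(\<lambda>T::real. sqrt T) \<in> o(\<lambda>T. T)" by real_asymp
  ultimately have "(\<lambda>T. card {p \<in> S 1 l T. essential l p} + (sqrt T + C * (T powr (1 - 1 / l) + 1))) \<in> o(\<lambda>T. T)"
    using assms(3) by (intro sum_in_smallo) auto
  moreover have "eventually (\<lambda>T. card (S 2 l T) \<le>
      card {p \<in> S 1 l T. essential l p} + (sqrt T + C * (T powr (1 - 1 / l) + 1))) at_top"
    using eventually_ge_at_top[of "max 1 T0"]
  proof eventually_elim
    case (elim T)
    then have T: "T \<ge> 1" "T \<ge> T0" by auto
    have "S 2 l T = {p \<in> S 2 l T. essential l p} \<union> {p \<in> S 2 l T. \<not> essential l p}" by auto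
    then have "card (S 2 l T) \<le> card {p \<in> S 2 l T. essential l p} + card {p \<in> S 2 l T. \<not> essential l p}"
      by (metis card_Un_le)
    moreover have "card {p \<in> S 2 l T. essential l p} \<le> card {p \<in> S 1 l T. essential l p}"
      using finite_S[OF assms(1) T(1)] S2_subset_S1[of T l] T by (intro card_mono) auto
    ultimately show ?case using C[OF T(2)] by linarith
  qed
  then have "(\<lambda>T. real (card (S 2 l T))) \<in> O(\<lambda>T. card {p \<in> S 1 l T. essential l p} + (sqrt T + C * (T powr (1 - 1 / l) + 1)))"
    by (intro bigoI[of _ 1]) (auto elim!: eventually_mono)
  ultimately show ?thesis by (rule landau_o.big_small_trans[rotated])
qed

end
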